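(* Let $G$ be a finite simple graph, and let $H=\mathrm{Sub}(G)$ be its 1-subdivision. The following are equivalent: (i) $t(G,g)\ge\left(\int_{[0,1]^2}g\,d\mu^2\right)^{|E(G)|}$ for every completely positive function $g$ on $[0,1]^2$; (ii) $t(H,h)\ge\left(\int_{[0,1]^2}h\,d\mu^2\right)^{|E(H)|}$ for every (not necessarily symmetric) bounded measurable nonnegative function $h$ on $[0,1]^2$.
   Context: $\mu$ is Lebesgue measure on $[0,1]$. A bounded measurable nonnegative symmetric function $g$ on $[0,1]^2$ is called completely positive if there is a bounded measurable nonnegative function $h$ on $[0,1]^2$ with $g(x,y)=\int_{[0,1]}h(x,z)h(y,z)\,d\mu(z)$ for (almost) all $x,y$. For a simple graph $G$ with vertices $v_1,\dots,v_n$ and edge set $E(G)$, $t(G,g)=\int_{[0,1]^n}\prod_{\{v_i,v_j\}\in E(G)}g(x_i,x_j)\,d\mu^n$. A bipartite graph $H$ comes with an ordered pair of vertex sets $V=\{v_1,\dots,v_n\}$, $W=\{w_1,\dots,w_m\}$ and edge set $E(H)\subseteq V\times W$; for a bounded measurable $h$ on $[0,1]^2$, $t(H,h)=\int_{[0,1]^{n+m}}\prod_{(v_i,w_j)\in E(H)}h(x_i,y_j)\,d\mu^{n+m}$. The 1-subdivision $\mathrm{Sub}(G)$ of a simple graph $G$ is the bipartite graph with first vertex set $V(G)$ and second vertex set $E(G)$, in which $v\in V(G)$ and $e\in E(G)$ form an edge iff $v\in e$ in $G$. *)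

theory Defs
  imports "HOL-Analysis.Analysis"
begin

record 'v graph =
  verts :: "'v set"
  edges :: "'v set set"

definition finite_simple_graph :: "'v graph \<Rightarrow> bool" where
  "finite_simple_graph G \<longleftrightarrow> finite (verts G) \<and> (\<forall>e\<in>edges G. e \<subseteq> verts G \<and> card e = 2)"

record ('v, 'w) bipartite_graph =
  left_verts :: "'v set"
  right_verts :: "'w set"
  bip_edges :: "('v \<times> 'w) set"

definition Sub :: "'v graph \<Rightarrow> ('v, 'v set) bipartite_graph" where
  "Sub G = \<lparr>left_verts = verts G, right_verts = edges G,
            bip_edges = {(v, e). v \<in> verts G \<and> e \<in> edges G \<and> v \<in> e}\<rparr>"

abbreviation mu :: "real measure" where
  "mu \<equiv> lebesgue_on {0..1}"

text \<open>
  The product measures of HOL-Analysis are not complete. Taking completions makes ``measurable''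
  mean Lebesgue measurable on the unit square and on the unit cubes below.
\<close>

definition mu2 :: "(real \<times> real) measure" where
  "mu2 = completion (mu \<Otimes>\<^sub>M mu)"

text \<open>
  Functions on the unit square are total functions on pairs of reals;
  their values outside the square are unconstrained and irrelevant.
\<close>

definition bdd_meas_nonneg :: "(real \<times> real \<Rightarrow> real) \<Rightarrow> bool" where
  "bdd_meas_nonneg h \<longleftrightarrow> h \<in> borel_measurable mu2 \<and>
     (\<exists>B. \<forall>x\<in>{0..1}. \<forall>y\<in>{0..1}. \<bar>h (x, y)\<bar> \<le> B) \<and>
     (\<forall>x\<in>{0..1}. \<forall>y\<in>{0..1}. 0 \<le> h (x, y))"

definition completely_positive :: "(real \<times> real \<Rightarrow> real) \<Rightarrow> bool" where
  "completely_positive g \<longleftrightarrow> bdd_meas_nonneg g \<and>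
     (\<forall>x\<in>{0..1}. \<forall>y\<in>{0..1}. g (x, y) = g (y, x)) \<and>
     (\<exists>h. bdd_meas_nonneg h \<and>
        (AE (x, y) in mu2. g (x, y) = (\<integral>z. h (x, z) * h (y, z) \<partial>mu)))"

text \<open>
  An arbitrary ordering of the two endpoints of an edge. The density \<open>t_graph\<close> is only meaningful
  for symmetric \<open>g\<close>, and then its value does not depend on the ordering.
\<close>

definition ends :: "'v set \<Rightarrow> 'v \<times> 'v" where
  "ends e = (SOME p. e = {fst p, snd p})"

definition t_graph :: "'v graph \<Rightarrow> (real \<times> real \<Rightarrow> real) \<Rightarrow> real" where
  "t_graph G g =
     (\<integral>x. (\<Prod>e\<in>edges G. g (x (fst (ends e)), x (snd (ends e))))
        \<partial>completion (Pi\<^sub>M (verts G) (\<lambda>_. mu)))"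

definition t_bipartite :: "('v, 'w) bipartite_graph \<Rightarrow> (real \<times> real \<Rightarrow> real) \<Rightarrow> real" where
  "t_bipartite H h =
     (\<integral>(x, y). (\<Prod>(v, w)\<in>bip_edges H. h (x v, y w))
        \<partial>completion (Pi\<^sub>M (left_verts H) (\<lambda>_. mu) \<Otimes>\<^sub>M Pi\<^sub>M (right_verts H) (\<lambda>_. mu)))"

end

theory Submission
  imports Defs "HOL-Probability.Weak_Convergence" "HOL-Probability.Infinite_Product_Measure"
begin

text \<open>
  For a kernel \<open>h\<close> let \<open>gram h (x, y)\<close> be the integral of \<open>h (x, z) * h (y, z)\<close> over \<open>z\<close>. In
  \<open>Sub G\<close> every edge of \<open>G\<close> carries a midpoint joined to its two ends; integrating out the midpoints
  replaces each of them by a factor \<open>gram h\<close>, so \<open>t_bipartite (Sub G) h = t_graph G (gram h)\<close>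
  (\<open>t_bipartite_Sub_eq_t_graph_gram\<close>). Completely positive functions are, up to null sets, the
  functions \<open>gram h\<close>, and \<open>Sub G\<close> has twice as many edges as \<open>G\<close>. The equivalence therefore reduces
  to comparing the integral of \<open>gram h\<close> with the square of the integral of \<open>h\<close>. With
  \<open>d z\<close> the integral of \<open>h (x, z)\<close> over \<open>x\<close>, these numbers are the second moment of \<open>d\<close> and the
  square of its first moment (\<open>integral_gram\<close>, \<open>integral_kernel\<close>).

  Since a second moment is at least the square of the mean, (i) implies (ii).

  For the converse the two numbers must be made equal, that is, \<open>d\<close> must become constant, without
  changing \<open>gram h\<close>. The Gram kernel is unchanged if the measure on the \<open>z\<close>-axis is
  multiplied by a density \<open>w\<close> and \<open>h (x, z)\<close> is divided by the square root of \<open>w z\<close>. Choosing \<open>w\<close>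
  proportional to \<open>d\<^sup>2\<close> turns the fibre masses into a constant. Two repairs are needed. The quotient
  \<open>h / d\<close> may be unbounded, so first all fibres with \<open>d z < \<epsilon>\<close> are erased; this can only decrease
  \<open>gram h\<close>, and decreases its integral by at most \<open>\<epsilon>\<^sup>2\<close>. And the \<open>z\<close>-axis has to carry Lebesgue
  measure again, so the new kernel is pulled back along a map that pushes Lebesgue measure forward
  to the measure with density \<open>w\<close>, namely the quantile function of that measure
  (\<open>exists_pushforward_eq_density\<close>). The resulting kernel \<open>k\<close> of \<open>exists_equalised_kernel\<close>
  satisfies \<open>gram k \<le> gram h\<close> on the unit square, and the square of its integral is at least that of \<open>gram h\<close>
  minus \<open>\<epsilon>\<^sup>2\<close>. Applying (ii) to \<open>k\<close> and letting \<open>\<epsilon>\<close> tend to \<open>0\<close> gives (i).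
\<close>

section \<open>Product measures over the unit interval\<close>

interpretation mu: prob_space mu
  by (rule prob_spaceI) (simp add: emeasure_restrict_space space_restrict_space)

interpretation mu_pair: pair_prob_space mu mu
  by unfold_locales

interpretation mu_prod: product_prob_space "\<lambda>_. mu" UNIV
  by unfold_locales

lemma space_mu [simp]: "space mu = {0..1}"
  by (simp add: space_restrict_space)

lemma complete_measure_mu: "complete_measure mu"
proof
  fix A B assume "B \<subseteq> A" "A \<in> null_sets mu"
  then have A: "A \<subseteq> {0..1}" "A \<in> null_sets lebesgue"
    by (auto simp: null_sets_restrict_space)
  with \<open>B \<subseteq> A\<close> have "B \<in> sets lebesgue"
    by (auto intro: completion.complete)
  with A \<open>B \<subseteq> A\<close> show "B \<in> sets mu"
    by (auto simp: sets_restrict_space_iff)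
qed

lemma (in complete_measure) measurable_cong_AE:
  assumes f: "f \<in> M \<rightarrow>\<^sub>M N" and ae: "AE x in M. g x = f x"
    and g: "g \<in> space M \<rightarrow> space N"
  shows "g \<in> M \<rightarrow>\<^sub>M N"
proof (rule measurableI)
  fix A assume A: "A \<in> sets N"
  have 1: "f -` A \<inter> space M \<in> sets M"
    using f A by (rule measurable_sets)
  have 2: "AE x in M. x \<in> f -` A \<inter> space M \<longleftrightarrow> x \<in> g -` A \<inter> space M"
    using ae by eventually_elim auto
  show "g -` A \<inter> space M \<in> sets M"
    by (rule in_sets_AE[OF 2 1]) simp
qed (use g in auto)

lemma prob_space_PiM_mu: "prob_space (Pi\<^sub>M I (\<lambda>_. mu))"
  by (intro prob_space_PiM) (rule mu.prob_space_axioms)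

text \<open>
  This lets almost-everywhere statements on the square be transferred to the cubes over which the
  densities are integrated. For \<open>u = v\<close> the image measure would be concentrated on the diagonal, a
  null set.
\<close>

lemma distr_PiM_mu_pair:
  assumes "finite I" "u \<in> I" "v \<in> I" "u \<noteq> v"
  shows "distr (Pi\<^sub>M I (\<lambda>_. mu)) (mu \<Otimes>\<^sub>M mu) (\<lambda>x. (x u, x v)) = mu \<Otimes>\<^sub>M mu"
proof (rule pair_measure_eqI[symmetric])
  fix A B assume AB: "A \<in> sets mu" "B \<in> sets mu"
  define X where "X i = (if i = u then A else if i = v then B else {0..1})" for i
  have X: "X i \<in> sets mu" for i
    using AB sets.top[of mu] unfolding space_mu by (auto simp: X_def)
  have "emeasure (distr (Pi\<^sub>M I (\<lambda>_. mu)) (mu \<Otimes>\<^sub>M mu) (\<lambda>x. (x u, x v))) (A \<times> B)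
      = emeasure (Pi\<^sub>M I (\<lambda>_. mu)) ((\<lambda>x. (x u, x v)) -` (A \<times> B) \<inter> space (Pi\<^sub>M I (\<lambda>_. mu)))"
    using AB assms by (intro emeasure_distr) auto
  also have "(\<lambda>x. (x u, x v)) -` (A \<times> B) \<inter> space (Pi\<^sub>M I (\<lambda>_. mu)) = Pi\<^sub>E I X"
  proof -
    have "X i \<subseteq> {0..1}" for i
      using X[THEN sets.sets_into_space] by simp
    then have "Pi\<^sub>E I X \<subseteq> Pi\<^sub>E I (\<lambda>_. {0..1})"
      by (intro PiE_mono) auto
    moreover have "x u \<in> X u \<and> x v \<in> X v" if "x \<in> Pi\<^sub>E I X" for x
      using that assms by blast
    moreover have "x \<in> Pi\<^sub>E I X" if "x \<in> Pi\<^sub>E I (\<lambda>_. {0..1})" "x u \<in> A" "x v \<in> B" for x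
      using that by (auto simp: PiE_iff X_def)
    ultimately show ?thesis
      using assms(4) by (auto simp: space_PiM X_def)
  qed
  also have "emeasure (Pi\<^sub>M I (\<lambda>_. mu)) (Pi\<^sub>E I X) = (\<Prod>i\<in>I. emeasure mu (X i))"
    using X assms by (intro mu_prod.emeasure_PiM) auto
  also have "\<dots> = (\<Prod>i\<in>{u, v}. emeasure mu (X i))"
    using assms mu.emeasure_space_1 unfolding space_mu
    by (intro prod.mono_neutral_right) (auto simp: X_def)
  also have "\<dots> = emeasure mu A * emeasure mu B"
    using assms by (simp add: X_def)
  finally show "emeasure mu A * emeasure mu B
      = emeasure (distr (Pi\<^sub>M I (\<lambda>_. mu)) (mu \<Otimes>\<^sub>M mu) (\<lambda>x. (x u, x v))) (A \<times> B)" ..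
qed (rule mu.sigma_finite_measure_axioms mu.sigma_finite_measure_axioms sets_distr[symmetric])+

lemma distr_PiM_pair_mu:
  assumes "finite I" "finite J" "u \<in> I" "v \<in> J"
  shows "distr (Pi\<^sub>M I (\<lambda>_. mu) \<Otimes>\<^sub>M Pi\<^sub>M J (\<lambda>_. mu)) (mu \<Otimes>\<^sub>M mu) (\<lambda>(x, y). (x u, y v)) = mu \<Otimes>\<^sub>M mu"
proof -
  have c: "distr (Pi\<^sub>M K (\<lambda>_. mu)) mu (\<lambda>x. x k) = mu" if "finite K" "k \<in> K" for K and k :: 'c
    using that by (intro distr_PiM_component) (auto intro: mu.prob_space_axioms)
  show ?thesis
    using pair_measure_distr[OF measurable_component_singleton[OF assms(3), of "\<lambda>_. mu"]
        measurable_component_singleton[OF assms(4), of "\<lambda>_. mu"]]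
      mu.sigma_finite_measure_axioms
    unfolding c[OF assms(1,3)] c[OF assms(2,4)] by metis
qed

text \<open>
  A measure-preserving map stays measurable when both measures are completed, because preimages of
  null sets are null.
\<close>

lemma completion_pushforward:
  assumes p: "p \<in> M \<rightarrow>\<^sub>M N" and d: "distr M N p = N"
  shows "p \<in> completion M \<rightarrow>\<^sub>M completion N"
    and "(AE x in completion N. P x) \<Longrightarrow> (AE x in completion M. P (p x))"
proof -
  show "p \<in> completion M \<rightarrow>\<^sub>M completion N"
    using p d by (intro completion.measurable_completion2) (auto simp: distr_completion measurable_completion)
  assume "AE x in completion N. P x"
  then have "AE x in distr M N p. P x"
    unfolding d AE_completion_iff .
  with p show "AE x in completion M. P (p x)"
    by (intro AE_completion) (rule AE_distrD)
qed

section \<open>Bounded kernels\<close>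

text \<open>
  Measurability is required for the plain product, where Fubini's theorem applies directly, and
  the bounds hold also outside the square, so that no support conditions need to be carried along.
\<close>

definition bounded_kernel :: "real \<Rightarrow> (real \<times> real \<Rightarrow> real) \<Rightarrow> bool" where
  "bounded_kernel B h \<longleftrightarrow> h \<in> borel_measurable (mu \<Otimes>\<^sub>M mu) \<and> (\<forall>p. 0 \<le> h p \<and> h p \<le> B)"

lemma bounded_kernelD:
  assumes "bounded_kernel B h"
  shows "h \<in> borel_measurable (mu \<Otimes>\<^sub>M mu)" "\<And>p. 0 \<le> h p" "\<And>p. h p \<le> B" "0 \<le> B"
  using assms unfolding bounded_kernel_def by (blast, blast, blast, meson order_trans)

lemma bounded_kernel_mult:
  assumes "bounded_kernel B h"
  shows "0 \<le> h p * h q" "h p * h q \<le> B * B"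
  by (intro mult_nonneg_nonneg bounded_kernelD[OF assms])
     (intro mult_mono bounded_kernelD[OF assms])

lemma bounded_kernel_imp_bdd_meas_nonneg:
  "bounded_kernel B h \<Longrightarrow> bdd_meas_nonneg h"
  unfolding bounded_kernel_def bdd_meas_nonneg_def mu2_def
  by (auto intro!: measurable_completion exI[of _ B])

text \<open>
  Truncating a product-measurable version of \<open>h\<close> at \<open>0\<close> and at the bound of \<open>h\<close> changes it only
  on a null set, since \<open>h\<close> itself lies between these values on the whole square.
\<close>

lemma bdd_meas_nonneg_representative:
  assumes "bdd_meas_nonneg h"
  obtains B h0 where "bounded_kernel B h0" "AE p in mu2. h p = h0 p"
proof -
  obtain B where h: "h \<in> borel_measurable mu2" "\<And>x y. x \<in> {0..1} \<Longrightarrow> y \<in> {0..1} \<Longrightarrow> \<bar>h (x, y)\<bar> \<le> B"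
      "\<And>x y. x \<in> {0..1} \<Longrightarrow> y \<in> {0..1} \<Longrightarrow> 0 \<le> h (x, y)"
    using assms unfolding bdd_meas_nonneg_def by blast
  obtain f where f: "f \<in> borel_measurable (mu \<Otimes>\<^sub>M mu)" "AE p in mu \<Otimes>\<^sub>M mu. h p = f p"
    using completion_ex_borel_measurable_real h(1) unfolding mu2_def by blast
  \<comment> \<open>Without this the two truncations would be incompatible.\<close>
  have "0 \<le> B"
    using h(2)[of 0 0] by force
  then have "bounded_kernel B (\<lambda>p. max 0 (min B (f p)))"
    using f unfolding bounded_kernel_def by auto
  moreover have "AE p in mu \<Otimes>\<^sub>M mu. h p = max 0 (min B (f p))"
    using f(2) AE_space
  proof eventually_elim
    case (elim p)
    then show ?case
      using h(2,3)[of "fst p" "snd p"] by (auto simp: space_pair_measure)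
  qed
  ultimately show thesis
    using that AE_completion unfolding mu2_def by blast
qed

lemma (in prob_space) integrable_bounded:
  fixes f :: "'a \<Rightarrow> real"
  assumes "f \<in> borel_measurable M" "\<And>x. 0 \<le> f x" "\<And>x. f x \<le> B"
  shows "integrable M f"
  using assms by (intro integrable_const_bound[of _ B]) auto

definition gram :: "(real \<times> real \<Rightarrow> real) \<Rightarrow> real \<times> real \<Rightarrow> real" where
  "gram h = (\<lambda>(x, y). \<integral>z. h (x, z) * h (y, z) \<partial>mu)"

lemma integrable_gram_integrand:
  assumes h: "bounded_kernel B h" and "x \<in> {0..1}" "y \<in> {0..1}"
  shows "integrable mu (\<lambda>z. h (x, z) * h (y, z))"
proof (rule mu.integrable_bounded[where B = "B * B"])
  note [measurable] = bounded_kernelD(1)[OF h]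
  have [measurable]: "x \<in> space mu" "y \<in> space mu"
    using assms by simp_all
  show "(\<lambda>z. h (x, z) * h (y, z)) \<in> borel_measurable mu"
    by measurable
qed (use bounded_kernel_mult[OF h] in auto)

lemma gram_commute: "gram h (x, y) = gram h (y, x)"
  by (simp add: gram_def mult.commute)

lemma bounded_kernel_gram:
  assumes h: "bounded_kernel B h"
  shows "bounded_kernel (B * B) (gram h)"
proof -
  note [measurable] = bounded_kernelD(1)[OF h]
  have le: "gram h (x, y) \<le> B * B" for x y
  proof (cases "integrable mu (\<lambda>z. h (x, z) * h (y, z))")
    case True
    then show ?thesis
      unfolding gram_def using bounded_kernel_mult[OF h] by (auto intro!: mu.integral_le_const)
  next
    case False
    then show ?thesis
      using bounded_kernelD[OF h] by (simp add: gram_def not_integrable_integral_eq)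
  qed
  have "gram h \<in> borel_measurable (mu \<Otimes>\<^sub>M mu)"
    unfolding gram_def by measurable
  with le show ?thesis
    using bounded_kernelD[OF h] by (auto simp: bounded_kernel_def gram_def intro!: integral_nonneg)
qed

text \<open>
  By Fubini almost every section of \<open>h\<close> agrees almost everywhere with the corresponding section of
  \<open>h0\<close>. Completeness of \<open>mu\<close> then makes these sections of \<open>h\<close> measurable, so that the two
  integrals defining the Gram kernels really agree.
\<close>

lemma gram_cong_AE:
  assumes h: "bdd_meas_nonneg h" and h0: "bounded_kernel B h0" and ae: "AE p in mu2. h p = h0 p"
  shows "AE (x, y) in mu2. gram h (x, y) = gram h0 (x, y)"
proof -
  note [measurable] = bounded_kernelD(1)[OF h0]
  have "AE p in mu \<Otimes>\<^sub>M mu. h p = h0 p"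
    using ae unfolding mu2_def AE_completion_iff .
  then have good: "AE x in mu. AE z in mu. h (x, z) = h0 (x, z)"
    by (rule mu_pair.AE_pair)
  then have 1: "AE p in mu \<Otimes>\<^sub>M mu. AE z in mu. h (fst p, z) = h0 (fst p, z)"
    by (intro AE_distrD[where M' = mu and f = fst]) (simp, unfold mu.distr_pair_fst)
  (* The statement for the second coordinate follows by the symmetry of the product measure. *)
  then have "AE p in distr (mu \<Otimes>\<^sub>M mu) (mu \<Otimes>\<^sub>M mu) (\<lambda>(x, y). (y, x)).
      AE z in mu. h (fst p, z) = h0 (fst p, z)"
    unfolding mu_pair.distr_pair_swap[symmetric] .
  then have "AE p in mu \<Otimes>\<^sub>M mu. AE z in mu.
      h (fst (case p of (x, y) \<Rightarrow> (y, x)), z) = h0 (fst (case p of (x, y) \<Rightarrow> (y, x)), z)"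
    by (rule AE_distrD[OF measurable_pair_swap'])
  with 1 have "AE p in mu \<Otimes>\<^sub>M mu. gram h p = gram h0 p"
    using AE_space
  proof eventually_elim
    case (elim p)
    obtain x y where p: "p = (x, y)" by fastforce
    with elim have xy: "x \<in> space mu" "y \<in> space mu"
      by (auto simp: space_pair_measure)
    have [measurable]: "(\<lambda>z. h0 (x, z)) \<in> borel_measurable mu" "(\<lambda>z. h0 (y, z)) \<in> borel_measurable mu"
      using xy by measurable
    have ae: "AE z in mu. h (x, z) = h0 (x, z)" "AE z in mu. h (y, z) = h0 (y, z)"
      using elim unfolding p by simp_all
    have [measurable]: "(\<lambda>z. h (x, z)) \<in> borel_measurable mu"
      by (rule complete_measure.measurable_cong_AE[OF complete_measure_mu _ ae(1)]) auto
    have [measurable]: "(\<lambda>z. h (y, z)) \<in> borel_measurable mu"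
      by (rule complete_measure.measurable_cong_AE[OF complete_measure_mu _ ae(2)]) auto
    have "AE z in mu. h (x, z) * h (y, z) = h0 (x, z) * h0 (y, z)"
      using ae by eventually_elim simp
    then show ?case
      unfolding p gram_def by (simp only: prod.case) (rule integral_cong_AE; measurable)
  qed
  then show ?thesis
    unfolding mu2_def by (intro AE_completion) simp
qed

section \<open>Homomorphism densities\<close>

lemma ends_edge:
  assumes "finite_simple_graph G" "e \<in> edges G"
  shows "e = {fst (ends e), snd (ends e)}" "fst (ends e) \<noteq> snd (ends e)"
    "fst (ends e) \<in> verts G" "snd (ends e) \<in> verts G"
proof -
  have e: "e \<subseteq> verts G" "card e = 2"
    using assms by (auto simp: finite_simple_graph_def)
  then obtain u v where "e = {fst (u, v), snd (u, v)}"
    by (auto simp: card_2_iff)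
  then show 1: "e = {fst (ends e), snd (ends e)}"
    unfolding ends_def by (rule someI)
  show "fst (ends e) \<noteq> snd (ends e)"
  proof
    assume "fst (ends e) = snd (ends e)"
    with 1 have "card e = card {fst (ends e)}"
      by simp
    with e(2) show False
      by simp
  qed
  show "fst (ends e) \<in> verts G" "snd (ends e) \<in> verts G"
    using 1 e(1) by blast+
qed

lemma finite_graph:
  assumes "finite_simple_graph G"
  shows "finite (verts G)" "finite (edges G)" "\<And>e. e \<in> edges G \<Longrightarrow> finite e"
proof -
  show "finite (verts G)"
    using assms by (simp add: finite_simple_graph_def)
  moreover have "edges G \<subseteq> Pow (verts G)"
    using assms by (auto simp: finite_simple_graph_def)
  ultimately show "finite (edges G)" "\<And>e. e \<in> edges G \<Longrightarrow> finite e"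
    by (auto intro: finite_subset)
qed

lemma bip_edges_Sub:
  assumes "finite_simple_graph G"
  shows "bip_edges (Sub G) = prod.swap ` (SIGMA e:edges G. e)"
  using assms by (force simp: Sub_def finite_simple_graph_def)

lemma prod_bip_edges_Sub:
  assumes G: "finite_simple_graph G"
  shows "(\<Prod>(v, e)\<in>bip_edges (Sub G). f v e) = (\<Prod>e\<in>edges G. f (fst (ends e)) e * f (snd (ends e)) e)"
proof -
  have "(\<Prod>(v, e)\<in>bip_edges (Sub G). f v e) = (\<Prod>(e, v)\<in>(SIGMA e:edges G. e). f v e)"
    unfolding bip_edges_Sub[OF G] by (subst prod.reindex) (auto simp: split_beta' inj_on_def)
  also have "\<dots> = (\<Prod>e\<in>edges G. \<Prod>v\<in>e. f v e)"
    using finite_graph[OF G] by (subst prod.Sigma) auto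
  also have "\<dots> = (\<Prod>e\<in>edges G. f (fst (ends e)) e * f (snd (ends e)) e)"
  proof (rule prod.cong)
    fix e assume "e \<in> edges G"
    note e = ends_edge[OF G this]
    have "(\<Prod>v\<in>e. f v e) = (\<Prod>v\<in>{fst (ends e), snd (ends e)}. f v e)"
      using e(1) by simp
    with e(2) show "(\<Prod>v\<in>e. f v e) = f (fst (ends e)) e * f (snd (ends e)) e"
      by simp
  qed simp
  finally show ?thesis .
qed

lemma card_bip_edges_Sub:
  assumes "finite_simple_graph G"
  shows "card (bip_edges (Sub G)) = 2 * card (edges G)"
proof -
  have "card (bip_edges (Sub G)) = card (SIGMA e:edges G. e)"
    unfolding bip_edges_Sub[OF assms] by (rule card_image) (auto simp: inj_on_def)
  also have "\<dots> = (\<Sum>e\<in>edges G. card e)"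
    using finite_graph[OF assms] by (intro card_SigmaI) auto
  also have "\<dots> = 2 * card (edges G)"
    using assms by (simp add: finite_simple_graph_def)
  finally show ?thesis .
qed

text \<open>
  Each edge has two distinct ends, so the pair of coordinates at its ends is uniformly distributed
  on the square and almost surely avoids the null set where \<open>g\<close> and \<open>g'\<close> differ. As there are
  finitely many edges, the two integrands agree almost everywhere.
\<close>

lemma t_graph_cong_AE:
  assumes G: "finite_simple_graph G"
    and g: "g \<in> borel_measurable mu2" and g': "g' \<in> borel_measurable mu2"
    and ae: "AE p in mu2. g p = g' p"
  shows "t_graph G g = t_graph G g'"
proof -
  let ?P = "Pi\<^sub>M (verts G) (\<lambda>_. mu)"
  have m: "(\<lambda>x. (x (fst (ends e)), x (snd (ends e)))) \<in> ?P \<rightarrow>\<^sub>M mu \<Otimes>\<^sub>M mu" if "e \<in> edges G" for e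
    using ends_edge[OF G that] by measurable
  note d = distr_PiM_mu_pair[OF finite_graph(1)[OF G] ends_edge(3,4,2)[OF G]]
  note c = completion_pushforward[OF m d, folded mu2_def]
  have "AE x in completion ?P. \<forall>e\<in>edges G.
      g (x (fst (ends e)), x (snd (ends e))) = g' (x (fst (ends e)), x (snd (ends e)))"
    using c(2)[OF _ _ _ _ ae] finite_graph(2)[OF G] by (intro AE_finite_allI) auto
  then have "AE x in completion ?P. (\<Prod>e\<in>edges G. g (x (fst (ends e)), x (snd (ends e))))
      = (\<Prod>e\<in>edges G. g' (x (fst (ends e)), x (snd (ends e))))"
    by eventually_elim (simp cong: prod.cong)
  then show ?thesis
    unfolding t_graph_def using measurable_compose[OF c(1) g] measurable_compose[OF c(1) g']
    by (intro integral_cong_AE borel_measurable_prod) auto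
qed

lemma t_bipartite_Sub_cong_AE:
  assumes G: "finite_simple_graph G"
    and h: "h \<in> borel_measurable mu2" and h': "h' \<in> borel_measurable mu2"
    and ae: "AE p in mu2. h p = h' p"
  shows "t_bipartite (Sub G) h = t_bipartite (Sub G) h'"
proof -
  let ?E = "bip_edges (Sub G)"
  let ?P = "Pi\<^sub>M (verts G) (\<lambda>_. mu) \<Otimes>\<^sub>M Pi\<^sub>M (edges G) (\<lambda>_. mu)"
  let ?c = "\<lambda>q (x, y). (x (fst q), y (snd q))"
  have E: "fst q \<in> verts G" "snd q \<in> edges G" if "q \<in> ?E" for q
    using that by (auto simp: Sub_def)
  have m: "?c q \<in> ?P \<rightarrow>\<^sub>M mu \<Otimes>\<^sub>M mu" if "q \<in> ?E" for q
    using E[OF that] by measurable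
  note d = distr_PiM_pair_mu[OF finite_graph(1)[OF G] finite_graph(2)[OF G] E]
  note c = completion_pushforward[OF m d, folded mu2_def]
  have "?E \<subseteq> verts G \<times> edges G"
    using E by fastforce
  then have fin: "finite ?E"
    using finite_graph(1,2)[OF G] finite_subset by blast
  have "AE x in completion ?P. \<forall>q\<in>?E. h (?c q x) = h' (?c q x)"
    using c(2)[OF _ _ _ ae] fin by (intro AE_finite_allI) auto
  then have "AE x in completion ?P. (\<Prod>q\<in>?E. h (?c q x)) = (\<Prod>q\<in>?E. h' (?c q x))"
    by eventually_elim (simp cong: prod.cong)
  then have "(\<integral>x. (\<Prod>q\<in>?E. h (?c q x)) \<partial>completion ?P) = (\<integral>x. (\<Prod>q\<in>?E. h' (?c q x)) \<partial>completion ?P)"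
    using measurable_compose[OF c(1) h] measurable_compose[OF c(1) h']
    by (intro integral_cong_AE borel_measurable_prod) auto
  then show ?thesis
    unfolding t_bipartite_def by (simp add: Sub_def split_beta')
qed


lemma bounded_kernel_measurable_mu2: "bounded_kernel B g \<Longrightarrow> g \<in> borel_measurable mu2"
  unfolding mu2_def by (intro measurable_completion bounded_kernelD(1))

lemma bounded_kernel_prod_bounds:
  assumes "bounded_kernel B g"
  shows "0 \<le> (\<Prod>i\<in>I. g (p i))" "(\<Prod>i\<in>I. g (p i)) \<le> B ^ card I"
  using bounded_kernelD(2,3)[OF assms] prod_mono[of I "\<lambda>i. g (p i)" "\<lambda>_. B"]
  by (simp_all add: prod_nonneg del: split_paired_All)

lemma t_graph_integrand_measurable:
  assumes G: "finite_simple_graph G" and g: "bounded_kernel B g"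
  shows "(\<lambda>x. \<Prod>e\<in>edges G. g (x (fst (ends e)), x (snd (ends e))))
    \<in> borel_measurable (Pi\<^sub>M (verts G) (\<lambda>_. mu))"
proof (rule borel_measurable_prod)
  fix e assume "e \<in> edges G"
  note [measurable] = ends_edge(3,4)[OF G this] bounded_kernelD(1)[OF g]
  show "(\<lambda>x. g (x (fst (ends e)), x (snd (ends e)))) \<in> borel_measurable (Pi\<^sub>M (verts G) (\<lambda>_. mu))"
    by measurable
qed

lemma t_graph_mono:
  assumes G: "finite_simple_graph G" and g: "bounded_kernel B g" and g': "bounded_kernel B' g'"
    and le: "\<And>x y. x \<in> {0..1} \<Longrightarrow> y \<in> {0..1} \<Longrightarrow> g (x, y) \<le> g' (x, y)"
  shows "t_graph G g \<le> t_graph G g'"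
proof -
  let ?P = "Pi\<^sub>M (verts G) (\<lambda>_. mu)"
  interpret P: prob_space ?P
    by (rule prob_space_PiM_mu)
  note m = t_graph_integrand_measurable[OF G g] t_graph_integrand_measurable[OF G g']
  have "(\<integral>x. (\<Prod>e\<in>edges G. g (x (fst (ends e)), x (snd (ends e)))) \<partial>?P)
      \<le> (\<integral>x. (\<Prod>e\<in>edges G. g' (x (fst (ends e)), x (snd (ends e)))) \<partial>?P)"
  proof (rule integral_mono)
    show "integrable ?P (\<lambda>x. \<Prod>e\<in>edges G. g (x (fst (ends e)), x (snd (ends e))))"
      using m(1) bounded_kernel_prod_bounds[OF g] by (rule P.integrable_bounded)
    show "integrable ?P (\<lambda>x. \<Prod>e\<in>edges G. g' (x (fst (ends e)), x (snd (ends e))))"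
      using m(2) bounded_kernel_prod_bounds[OF g'] by (rule P.integrable_bounded)
    fix x assume "x \<in> space ?P"
    then have "x v \<in> {0..1}" if "v \<in> verts G" for v
      using that by (auto simp: space_PiM)
    then show "(\<Prod>e\<in>edges G. g (x (fst (ends e)), x (snd (ends e))))
        \<le> (\<Prod>e\<in>edges G. g' (x (fst (ends e)), x (snd (ends e))))"
      using ends_edge(3,4)[OF G] bounded_kernelD(2)[OF g] by (intro prod_mono) (blast intro: le)
  qed
  then show ?thesis
    unfolding t_graph_def using m by (simp only: integral_completion)
qed

text \<open>
  For fixed positions of the vertices of \<open>G\<close>, the coordinate of a midpoint occurs only in the two
  factors of its own edge. Integrating over all midpoints therefore gives a product of
  one-dimensional integrals, one value of \<open>gram h\<close> per edge.
\<close>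

lemma t_bipartite_Sub_eq_t_graph_gram:
  assumes G: "finite_simple_graph G" and h: "bounded_kernel B h"
  shows "t_bipartite (Sub G) h = t_graph G (gram h)"
proof -
  let ?P = "Pi\<^sub>M (verts G) (\<lambda>_. mu)" and ?Q = "Pi\<^sub>M (edges G) (\<lambda>_. mu)"
  interpret P: prob_space ?P by (rule prob_space_PiM_mu)
  interpret Q: prob_space ?Q by (rule prob_space_PiM_mu)
  interpret PQ: pair_prob_space ?P ?Q by unfold_locales
  let ?u = "\<lambda>e. fst (ends e)" and ?v = "\<lambda>e. snd (ends e)"
  define F where "F x y = (\<Prod>e\<in>edges G. h (x (?u e), y e) * h (x (?v e), y e))" for x y
  note [measurable] = bounded_kernelD(1)[OF h]
  have F_bip: "(\<Prod>(v, e)\<in>bip_edges (Sub G). h (x v, y e)) = F x y" for x y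
    unfolding F_def by (rule prod_bip_edges_Sub[OF G])
  have F_meas: "(\<lambda>(x, y). F x y) \<in> borel_measurable (?P \<Otimes>\<^sub>M ?Q)"
    unfolding F_def split_beta'
  proof (rule borel_measurable_prod)
    fix e assume e: "e \<in> edges G"
    note [measurable] = e ends_edge(3,4)[OF G e]
    show "(\<lambda>p. h (fst p (?u e), snd p e) * h (fst p (?v e), snd p e)) \<in> borel_measurable (?P \<Otimes>\<^sub>M ?Q)"
      by measurable
  qed
  have F_bounds: "0 \<le> F x y" "F x y \<le> (B * B) ^ card (edges G)" for x y
    unfolding F_def
    using bounded_kernel_mult[OF h] prod_mono[of "edges G" "\<lambda>e. h (x (?u e), y e) * h (x (?v e), y e)" "\<lambda>_. B * B"]
    by (auto intro!: prod_nonneg)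
  have "t_bipartite (Sub G) h = (\<integral>(x, y). F x y \<partial>completion (?P \<Otimes>\<^sub>M ?Q))"
    unfolding t_bipartite_def F_bip by (simp add: Sub_def)
  also have "\<dots> = (\<integral>(x, y). F x y \<partial>(?P \<Otimes>\<^sub>M ?Q))"
    by (rule integral_completion[OF F_meas])
  also have "\<dots> = (\<integral>x. \<integral>y. F x y \<partial>?Q \<partial>?P)"
  proof -
    have "integrable (?P \<Otimes>\<^sub>M ?Q) (\<lambda>(x, y). F x y)"
      using F_bounds by (intro PQ.P.integrable_bounded[OF F_meas]) auto
    from PQ.integral_fst'[OF this] show ?thesis
      by simp
  qed
  also have "\<dots> = (\<integral>x. (\<Prod>e\<in>edges G. gram h (x (?u e), x (?v e))) \<partial>?P)"
  proof (rule Bochner_Integration.integral_cong[OF refl])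
    fix x assume x: "x \<in> space ?P"
    have "(\<integral>y. F x y \<partial>?Q) = (\<Prod>e\<in>edges G. \<integral>z. h (x (?u e), z) * h (x (?v e), z) \<partial>mu)"
      unfolding F_def
    proof (rule mu_prod.product_integral_prod[OF finite_graph(2)[OF G]])
      fix e assume e: "e \<in> edges G"
      have "x (?u e) \<in> {0..1}" "x (?v e) \<in> {0..1}"
        using x ends_edge(3,4)[OF G e] by (auto simp: space_PiM)
      then show "integrable mu (\<lambda>z. h (x (?u e), z) * h (x (?v e), z))"
        by (rule integrable_gram_integrand[OF h])
    qed
    then show "(\<integral>y. F x y \<partial>?Q) = (\<Prod>e\<in>edges G. gram h (x (?u e), x (?v e)))"
      by (simp add: gram_def)
  qed
  also have "\<dots> = t_graph G (gram h)"
    unfolding t_graph_def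
    by (intro integral_completion[symmetric] t_graph_integrand_measurable[OF G bounded_kernel_gram[OF h]])
  finally show ?thesis .
qed

section \<open>The integral of a Gram kernel\<close>

definition fibre_mass :: "(real \<times> real \<Rightarrow> real) \<Rightarrow> real \<Rightarrow> real" where
  "fibre_mass h z = (\<integral>x. h (x, z) \<partial>mu)"

lemma fibre_mass_measurable:
  assumes [measurable]: "h \<in> borel_measurable (mu \<Otimes>\<^sub>M mu)"
  shows "fibre_mass h \<in> borel_measurable mu"
  unfolding fibre_mass_def by measurable

lemma fibre_mass_bounds:
  assumes "bounded_kernel B h"
  shows "0 \<le> fibre_mass h z" "fibre_mass h z \<le> B"
proof -
  show "0 \<le> fibre_mass h z"
    unfolding fibre_mass_def by (intro Bochner_Integration.integral_nonneg bounded_kernelD[OF assms])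
  show "fibre_mass h z \<le> B"
  proof (cases "integrable mu (\<lambda>x. h (x, z))")
    case True
    then show ?thesis
      unfolding fibre_mass_def using bounded_kernelD[OF assms] by (auto intro!: mu.integral_le_const)
  next
    case False
    then show ?thesis
      using bounded_kernelD[OF assms] by (simp add: fibre_mass_def not_integrable_integral_eq)
  qed
qed

lemma integral_mu2_kernel:
  "bounded_kernel B h \<Longrightarrow> (\<integral>p. h p \<partial>mu2) = (\<integral>p. h p \<partial>(mu \<Otimes>\<^sub>M mu))"
  unfolding mu2_def by (intro integral_completion bounded_kernelD(1))

lemma integral_kernel:
  assumes "bounded_kernel B h"
  shows "(\<integral>p. h p \<partial>mu2) = (\<integral>z. fibre_mass h z \<partial>mu)"
proof -
  have "integrable (mu \<Otimes>\<^sub>M mu) (\<lambda>(x, z). h (x, z))"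
    using mu_pair.P.integrable_bounded[OF bounded_kernelD(1,2,3)[OF assms]] by simp
  from mu_pair.integral_snd[OF this] show ?thesis
    unfolding integral_mu2_kernel[OF assms] fibre_mass_def by simp
qed

text \<open>
  Integrating over \<open>x\<close> and \<open>y\<close> before \<open>z\<close> separates the two factors of the Gram kernel.
\<close>

lemma integral_gram:
  assumes h: "bounded_kernel B h"
  shows "(\<integral>p. gram h p \<partial>mu2) = (\<integral>z. (fibre_mass h z)\<^sup>2 \<partial>mu)"
proof -
  note [measurable] = bounded_kernelD(1)[OF h]
  interpret T: pair_prob_space "mu \<Otimes>\<^sub>M mu" mu
    by unfold_locales
  note B = bounded_kernel_mult[OF h]
  have i: "integrable ((mu \<Otimes>\<^sub>M mu) \<Otimes>\<^sub>M mu) (\<lambda>(p, z). h (fst p, z) * h (snd p, z))"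
    using B by (intro T.P.integrable_bounded[where B = "B * B"]) (measurable, auto)
  have "(\<integral>p. gram h p \<partial>mu2) = (\<integral>p. (\<integral>z. h (fst p, z) * h (snd p, z) \<partial>mu) \<partial>(mu \<Otimes>\<^sub>M mu))"
    unfolding integral_mu2_kernel[OF bounded_kernel_gram[OF h]] by (simp add: gram_def split_beta')
  also have "\<dots> = (\<integral>z. (\<integral>p. h (fst p, z) * h (snd p, z) \<partial>(mu \<Otimes>\<^sub>M mu)) \<partial>mu)"
    using T.Fubini_integral[OF i] by simp
  also have "\<dots> = (\<integral>z. (fibre_mass h z)\<^sup>2 \<partial>mu)"
  proof (rule Bochner_Integration.integral_cong[OF refl])
    fix z assume [measurable]: "z \<in> space mu"
    have "integrable (mu \<Otimes>\<^sub>M mu) (\<lambda>(x, y). h (x, z) * h (y, z))"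
      using B by (intro mu_pair.P.integrable_bounded[where B = "B * B"]) (measurable, auto)
    from mu_pair.integral_fst'[OF this]
    have "(\<integral>p. h (fst p, z) * h (snd p, z) \<partial>(mu \<Otimes>\<^sub>M mu)) = (\<integral>x. \<integral>y. h (x, z) * h (y, z) \<partial>mu \<partial>mu)"
      by (simp add: split_beta')
    then show "(\<integral>p. h (fst p, z) * h (snd p, z) \<partial>(mu \<Otimes>\<^sub>M mu)) = (fibre_mass h z)\<^sup>2"
      by (simp add: fibre_mass_def power2_eq_square)
  qed
  finally show ?thesis .
qed

text \<open>
  The difference of the two sides is the variance of the fibre mass.
\<close>

lemma square_integral_le_integral_gram:
  assumes h: "bounded_kernel B h"
  shows "(\<integral>p. h p \<partial>mu2)\<^sup>2 \<le> (\<integral>p. gram h p \<partial>mu2)"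
proof -
  note [measurable] = fibre_mass_measurable[OF bounded_kernelD(1)[OF h]]
  note b = fibre_mass_bounds[OF h]
  have "integrable mu (fibre_mass h)"
    using b by (intro mu.integrable_bounded) auto
  moreover have "integrable mu (\<lambda>z. (fibre_mass h z)\<^sup>2)"
    using b by (intro mu.integrable_bounded[where B = "B\<^sup>2"]) (auto intro: power_mono)
  ultimately have "0 \<le> (\<integral>z. (fibre_mass h z)\<^sup>2 \<partial>mu) - (\<integral>z. fibre_mass h z \<partial>mu)\<^sup>2"
    using mu.variance_positive[of "fibre_mass h"] by (simp add: mu.variance_eq)
  then show ?thesis
    by (simp add: integral_kernel[OF h] integral_gram[OF h])
qed


section \<open>Realising a probability density as a pushforward\<close>

lemma AE_lborel_imp_AE_mu:
  assumes "AE x in lborel. P x"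
  shows "AE x in mu. P x"
proof -
  have "AE x in lebesgue. P x"
    using assms by (rule AE_completion)
  then have "AE x in lebesgue. x \<in> {0..1} \<longrightarrow> P x"
    by eventually_elim simp
  then show ?thesis
    by (subst AE_restrict_space_iff) auto
qed

text \<open>
  The quantile function of \<open>N\<close> maps the uniform distribution to \<open>N\<close>. It is redefined as \<open>0\<close> at the
  arguments outside the open unit interval, where the infimum defining it is meaningless, and
  wherever its value lies outside the unit interval, which carries all of \<open>N\<close>; within the unit
  interval this affects a null set only.
\<close>

lemma exists_borel_quantile:
  assumes "real_distribution N" and supp: "AE x in N. x \<in> {0..1}"
  obtains \<phi> where "\<phi> \<in> borel_measurable borel" "\<And>t. \<phi> t \<in> {0..1}"
    "\<And>A. A \<in> sets borel \<Longrightarrow> emeasure mu (\<phi> -` A \<inter> {0..1}) = emeasure N A"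
proof -
  interpret C: cdf_distribution N
    using assms(1) by (simp add: cdf_distribution_def)
  let ?R = "restrict_space lborel {0<..<1::real}"
  define J where "J t = (if t \<in> {0<..<1} then C.I t else 0)" for t
  define \<phi> where "\<phi> t = (if J t \<in> {0..1} then J t else 0)" for t
  have [measurable]: "J \<in> borel_measurable borel"
    unfolding J_def
  proof (subst measurable_If_restrict_space_iff, unfold Collect_mem_eq)
    show "C.I \<in> borel_measurable (restrict_space borel {0<..<1}) \<and>
        (\<lambda>_. 0) \<in> borel_measurable (restrict_space borel {t. t \<notin> {0<..<1::real}})"
      using C.measurable_CI by simp
  qed simp
  have [measurable]: "\<phi> \<in> borel_measurable borel"
    unfolding \<phi>_def by measurable
  have CI: "C.I \<in> ?R \<rightarrow>\<^sub>M borel"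
    using C.measurable_CI by (simp cong: measurable_cong_sets add: measurable_restrict_space1 sets_restrict_space)
  have \<phi>R: "\<phi> \<in> ?R \<rightarrow>\<^sub>M borel"
    by (rule measurable_restrict_space1) simp
  have "AE t in ?R. C.I t \<in> {0..1}"
  proof (rule AE_distrD[OF CI])
    show "AE x in distr ?R borel C.I. x \<in> {0..1}"
      unfolding C.distr_I_eq_M by (rule supp)
  qed
  then have ae: "AE t in ?R. \<phi> t = C.I t"
    using AE_space by eventually_elim (auto simp: \<phi>_def J_def space_restrict_space)
  have "emeasure mu (\<phi> -` A \<inter> {0..1}) = emeasure N A" if [measurable]: "A \<in> sets borel" for A
  proof -
    have meas: "\<phi> -` A \<inter> S \<in> sets borel" if "S \<in> sets borel" for S
      using that measurable_sets[of \<phi> borel borel A] by auto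
    have "emeasure N A = emeasure (distr ?R borel C.I) A"
      by (simp only: C.distr_I_eq_M)
    also have "\<dots> = emeasure (distr ?R borel \<phi>) A"
      using ae by (intro arg_cong2[where f = emeasure] distr_cong_AE) (auto simp: CI \<phi>R)
    also have "\<dots> = emeasure ?R (\<phi> -` A \<inter> {0<..<1})"
      using emeasure_distr[OF \<phi>R that] by (simp add: space_restrict_space)
    also have "\<dots> = emeasure lborel (\<phi> -` A \<inter> {0<..<1})"
      by (rule emeasure_restrict_space) auto
    also have "\<dots> = emeasure lborel (\<phi> -` A \<inter> {0..1})"
    proof (rule emeasure_eq_AE)
      show "AE t in lborel. t \<in> \<phi> -` A \<inter> {0<..<1} \<longleftrightarrow> t \<in> \<phi> -` A \<inter> {0..1}"
        using AE_lborel_singleton[of 0] AE_lborel_singleton[of 1] by eventually_elim auto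
    qed (use meas in auto)
    also have "\<dots> = emeasure mu (\<phi> -` A \<inter> {0..1})"
      using meas by (subst emeasure_restrict_space) auto
    finally show ?thesis ..
  qed
  then show thesis
    using that[of \<phi>] by (auto simp: \<phi>_def)
qed

text \<open>
  On Borel sets this is the quantile transformation of the measure \<open>\<nu>\<close> with density \<open>w\<close>. The identity
  extends to all Lebesgue measurable sets because \<open>\<nu>\<close>, having a density, vanishes on Lebesgue null
  sets: preimages of null sets under \<open>\<phi>\<close> are null, which gives both the measurability of \<open>\<phi>\<close> into
  the completed space and the freedom to replace a Lebesgue set by its Borel part.
\<close>

lemma exists_pushforward_eq_density:
  assumes [measurable]: "w \<in> borel_measurable mu" and w0: "\<And>z. 0 \<le> w z"
    and w: "integrable mu w" "(\<integral>z. w z \<partial>mu) = 1"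
  obtains \<phi> where "\<phi> \<in> mu \<rightarrow>\<^sub>M mu" "distr mu mu \<phi> = density mu (\<lambda>z. ennreal (w z))"
proof -
  define \<nu> where "\<nu> = density mu (\<lambda>z. ennreal (w z))"
  have sets_\<nu>: "sets \<nu> = sets mu" and space_\<nu>: "space \<nu> = {0..1}"
    by (simp_all add: \<nu>_def)
  have AE_\<nu>: "AE x in \<nu>. P x" if "AE x in lborel. P x" for P
  proof -
    have "AE x in mu. 0 < ennreal (w x) \<longrightarrow> P x"
      using AE_lborel_imp_AE_mu[OF that] by eventually_elim simp
    then show ?thesis
      unfolding \<nu>_def by (subst AE_density) auto
  qed
  interpret \<nu>: prob_space \<nu>
  proof (rule prob_spaceI)
    have "emeasure \<nu> (space \<nu>) = (\<integral>\<^sup>+z. ennreal (w z) * indicator (space mu) z \<partial>mu)"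
      unfolding \<nu>_def by (subst emeasure_density) simp_all
    also have "\<dots> = (\<integral>\<^sup>+z. ennreal (w z) \<partial>mu)"
      by (rule nn_integral_cong) simp
    also have "\<dots> = 1"
      using w w0 by (simp add: nn_integral_eq_integral)
    finally show "emeasure \<nu> (space \<nu>) = 1" .
  qed
  have id: "(\<lambda>x. x) \<in> \<nu> \<rightarrow>\<^sub>M borel"
    using id_borel_measurable_lebesgue_on[of "{0..1}"] sets_\<nu> by (simp add: id_def cong: measurable_cong_sets)
  define N where "N = distr \<nu> borel (\<lambda>x. x)"
  have N: "emeasure N A = emeasure \<nu> (A \<inter> {0..1})" if "A \<in> sets borel" for A
    using that id by (simp add: N_def emeasure_distr space_\<nu>)
  have "real_distribution N"
    unfolding N_def using id by (rule \<nu>.real_distribution_distr)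
  moreover have "AE x in N. x \<in> {0..1}"
    unfolding N_def using id AE_space[of \<nu>] by (subst AE_distr_iff) (auto simp: space_\<nu>)
  ultimately obtain \<phi> where [measurable]: "\<phi> \<in> borel_measurable borel" and ran: "\<And>t. \<phi> t \<in> {0..1}"
    and \<phi>: "\<And>A. A \<in> sets borel \<Longrightarrow> emeasure mu (\<phi> -` A \<inter> {0..1}) = emeasure N A"
    by (rule exists_borel_quantile) auto
  have \<phi>_mu: "\<phi> \<in> mu \<rightarrow>\<^sub>M lborel"
    by (auto intro!: measurable_restrict_space1 measurable_completion)
  have push: "distr mu lborel \<phi> = distr \<nu> lborel (\<lambda>x. x)"
  proof (rule measure_eqI)
    fix A assume "A \<in> sets (distr mu lborel \<phi>)"
    then have A: "A \<in> sets borel"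
      by simp
    then show "emeasure (distr mu lborel \<phi>) A = emeasure (distr \<nu> lborel (\<lambda>x. x)) A"
      using \<phi>[OF A] N[OF A] \<phi>_mu id by (simp add: emeasure_distr space_\<nu>)
  qed simp
  have null: "A \<in> null_sets (distr mu lborel \<phi>)" if "A \<in> null_sets lborel" for A
  proof -
    have "AE x in \<nu>. x \<notin> A"
      using that by (intro AE_\<nu> AE_not_in)
    then have "emeasure \<nu> (A \<inter> {0..1}) = emeasure \<nu> {}"
      using that by (intro emeasure_eq_AE) (auto simp: sets_\<nu> sets_restrict_space)
    then show ?thesis
      using that N[of A] \<phi>[of A] \<phi>_mu by (auto simp: null_sets_def emeasure_distr)
  qed
  have AE_\<phi>: "AE t in mu. P (\<phi> t)" if "AE x in lborel. P x" for P
  proof (rule AE_distrD[OF \<phi>_mu])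
    from that obtain A where "A \<in> null_sets lborel" "{x \<in> space lborel. \<not> P x} \<subseteq> A"
      unfolding eventually_ae_filter by auto
    then show "AE x in distr mu lborel \<phi>. P x"
      unfolding eventually_ae_filter using null by auto
  qed
  have "\<phi> \<in> mu \<rightarrow>\<^sub>M lebesgue"
    using null by (intro complete_measure.measurable_completion2[OF complete_measure_mu \<phi>_mu]) auto
  then have \<phi>_mu_mu: "\<phi> \<in> mu \<rightarrow>\<^sub>M mu"
    using ran by (intro measurable_restrict_space2) auto
  moreover have "distr mu mu \<phi> = \<nu>"
  proof (rule measure_eqI)
    fix A assume "A \<in> sets (distr mu mu \<phi>)"
    then have A: "A \<in> sets mu" "A \<in> sets lebesgue" "A \<subseteq> {0..1}"
      by (auto simp: sets_restrict_space_iff)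
    define S where "S = main_part lborel A"
    have S: "S \<in> sets borel" and ae: "AE x in lborel. x \<in> S \<longleftrightarrow> x \<in> A"
      using main_part_sets[OF A(2)] AE_in_main_part[OF A(2)] by (simp_all add: S_def)
    have "emeasure (distr mu mu \<phi>) A = emeasure mu (\<phi> -` A \<inter> {0..1})"
      using \<phi>_mu_mu A by (simp add: emeasure_distr)
    also have "\<dots> = emeasure mu (\<phi> -` S \<inter> {0..1})"
    proof (rule emeasure_eq_AE)
      show "AE t in mu. t \<in> \<phi> -` A \<inter> {0..1} \<longleftrightarrow> t \<in> \<phi> -` S \<inter> {0..1}"
        using AE_\<phi>[OF ae] by eventually_elim auto
      show "\<phi> -` A \<inter> {0..1} \<in> sets mu"
        using measurable_sets[OF \<phi>_mu_mu A(1)] by simp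
      show "\<phi> -` S \<inter> {0..1} \<in> sets mu"
        using measurable_sets[OF \<phi>_mu] S by simp
    qed
    also have "\<dots> = emeasure \<nu> (S \<inter> {0..1})"
      using \<phi>[OF S] N[OF S] by simp
    also have "\<dots> = emeasure \<nu> A"
    proof (rule emeasure_eq_AE)
      show "AE x in \<nu>. x \<in> S \<inter> {0..1} \<longleftrightarrow> x \<in> A"
        using AE_\<nu>[OF ae] by eventually_elim (use A(3) in auto)
    qed (use A S in \<open>auto simp: sets_\<nu> sets_restrict_space\<close>)
    finally show "emeasure (distr mu mu \<phi>) A = emeasure \<nu> A" .
  qed (simp add: sets_\<nu>)
  ultimately show thesis
    using that by (simp add: \<nu>_def)
qed


section \<open>Equalising the fibre masses\<close>

text \<open>
  With \<open>d\<close> the fibre mass of \<open>h\<close> and \<open>q = d\<^sup>2\<close> on the fibres with \<open>d \<ge> \<epsilon>\<close>, \<open>q = 0\<close> elsewhere, let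
  \<open>Q\<close> be the integral of \<open>q\<close> and let \<open>\<phi>\<close> push Lebesgue measure forward to the density \<open>w = q / Q\<close>.
  The kernel \<open>k (x, t) = sqrt Q * h (x, \<phi> t) / d (\<phi> t)\<close> has fibre mass \<open>sqrt Q\<close> at almost every \<open>t\<close>,
  so its integral is \<open>sqrt Q\<close>. In its Gram kernel the factor \<open>Q / d\<^sup>2\<close> cancels against \<open>w\<close>, which
  leaves the part of \<open>gram h\<close> coming from the fibres with \<open>d \<ge> \<epsilon>\<close>.
\<close>

lemma exists_equalised_kernel:
  assumes h: "bounded_kernel B h" and eps: "0 < \<epsilon>" and small: "\<epsilon>\<^sup>2 < (\<integral>p. gram h p \<partial>mu2)"
  obtains C k where "bounded_kernel C k"
    "\<And>x y. x \<in> {0..1} \<Longrightarrow> y \<in> {0..1} \<Longrightarrow> gram k (x, y) \<le> gram h (x, y)"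
    "(\<integral>p. gram h p \<partial>mu2) - \<epsilon>\<^sup>2 \<le> (\<integral>p. k p \<partial>mu2)\<^sup>2"
proof -
  define d where "d = fibre_mass h"
  note d_bounds = fibre_mass_bounds[OF h, folded d_def]
  have [measurable]: "d \<in> borel_measurable mu"
    unfolding d_def by (rule fibre_mass_measurable[OF bounded_kernelD(1)[OF h]])
  note [measurable] = bounded_kernelD(1)[OF h]
  define q where "q z = (if \<epsilon> \<le> d z then (d z)\<^sup>2 else 0)" for z
  define Q where "Q = (\<integral>z. q z \<partial>mu)"
  have [measurable]: "q \<in> borel_measurable mu"
    unfolding q_def by measurable
  have d2: "0 \<le> (d z)\<^sup>2" "(d z)\<^sup>2 \<le> B\<^sup>2" for z
    using d_bounds[of z] by (auto intro: power_mono)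
  have q_bounds: "0 \<le> q z" "q z \<le> B\<^sup>2" for z
    using d2[of z] by (auto simp: q_def)
  have q_int: "integrable mu q"
    using q_bounds by (intro mu.integrable_bounded) auto
  \<comment> \<open>The erased fibres contribute at most \<open>\<epsilon>\<^sup>2\<close> to the second moment of \<open>d\<close>.\<close>
  have "(\<integral>p. gram h p \<partial>mu2) = (\<integral>z. (d z)\<^sup>2 \<partial>mu)"
    unfolding d_def by (rule integral_gram[OF h])
  also have "\<dots> \<le> (\<integral>z. q z + \<epsilon>\<^sup>2 \<partial>mu)"
  proof (rule integral_mono)
    show "integrable mu (\<lambda>z. (d z)\<^sup>2)"
      using d2 by (intro mu.integrable_bounded) auto
    show "integrable mu (\<lambda>z. q z + \<epsilon>\<^sup>2)"
      using q_int by simp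
    show "(d z)\<^sup>2 \<le> q z + \<epsilon>\<^sup>2" for z
      using d_bounds(1)[of z] power_mono[of "d z" \<epsilon> 2] by (auto simp: q_def)
  qed
  also have "\<dots> = Q + \<epsilon>\<^sup>2"
    using q_int mu.prob_space by (simp add: Q_def del: space_mu)
  finally have Q_ge: "(\<integral>p. gram h p \<partial>mu2) - \<epsilon>\<^sup>2 \<le> Q"
    by simp
  with small have Q_pos: "0 < Q"
    by simp
  define c where "c = sqrt Q"
  have c: "0 < c" "c * c = Q"
    using Q_pos by (simp_all add: c_def)
  define w where "w z = q z / Q" for z
  have [measurable]: "w \<in> borel_measurable mu"
    unfolding w_def by measurable
  have w0: "0 \<le> w z" for z
    using q_bounds Q_pos by (simp add: w_def)
  have w: "integrable mu w" "(\<integral>z. w z \<partial>mu) = 1"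
    using q_int Q_pos unfolding w_def by (simp_all add: Q_def)
  obtain \<phi> where [measurable]: "\<phi> \<in> mu \<rightarrow>\<^sub>M mu" and \<phi>: "distr mu mu \<phi> = density mu (\<lambda>z. ennreal (w z))"
    using exists_pushforward_eq_density[OF _ w0 w] by auto
  have push: "(\<integral>t. f (\<phi> t) \<partial>mu) = (\<integral>z. w z * f z \<partial>mu)"
    if [measurable]: "f \<in> borel_measurable mu" for f :: "real \<Rightarrow> real"
  proof -
    have "(\<integral>t. f (\<phi> t) \<partial>mu) = (\<integral>z. f z \<partial>distr mu mu \<phi>)"
      by (rule integral_distr[symmetric]) measurable
    also have "\<dots> = (\<integral>z. w z * f z \<partial>mu)"
      unfolding \<phi> using w0 by (subst integral_density) auto
    finally show ?thesis .
  qed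
  define k where "k = (\<lambda>(x, t). if \<epsilon> \<le> d (\<phi> t) then c * h (x, \<phi> t) / d (\<phi> t) else 0)"
  have "k \<in> borel_measurable (mu \<Otimes>\<^sub>M mu)"
    unfolding k_def by measurable
  moreover have "0 \<le> k (x, t)" "k (x, t) \<le> c * B / \<epsilon>" for x t
    using bounded_kernelD(2,3)[OF h, of "(x, \<phi> t)"] c eps bounded_kernelD(4)[OF h]
    by (auto simp: k_def intro!: frac_le mult_left_mono)
  ultimately have k: "bounded_kernel (c * B / \<epsilon>) k"
    unfolding bounded_kernel_def by auto
  have "(\<integral>p. k p \<partial>mu2) = (\<integral>t. fibre_mass k t \<partial>mu)"
    by (rule integral_kernel[OF k])
  also have "\<dots> = (\<integral>t. (if \<epsilon> \<le> d (\<phi> t) then c else 0) \<partial>mu)"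
  proof (rule Bochner_Integration.integral_cong[OF refl])
    fix t
    have "fibre_mass k t = c * d (\<phi> t) / d (\<phi> t)" if "\<epsilon> \<le> d (\<phi> t)"
      using that by (simp add: fibre_mass_def k_def d_def)
    then show "fibre_mass k t = (if \<epsilon> \<le> d (\<phi> t) then c else 0)"
      using eps by (auto simp: fibre_mass_def k_def)
  qed
  also have "\<dots> = (\<integral>z. w z * (if \<epsilon> \<le> d z then c else 0) \<partial>mu)"
    by (rule push) measurable
  also have "\<dots> = (\<integral>z. w z * c \<partial>mu)"
    by (rule Bochner_Integration.integral_cong) (auto simp: w_def q_def)
  also have "\<dots> = c"
    using w by simp
  finally have "(\<integral>p. k p \<partial>mu2)\<^sup>2 = Q"
    using c by (simp add: power2_eq_square)
  moreover have "gram k (x, y) \<le> gram h (x, y)" if xy: "x \<in> {0..1}" "y \<in> {0..1}" for x y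
  proof -
    have [measurable]: "x \<in> space mu" "y \<in> space mu"
      using xy by simp_all
    let ?f = "\<lambda>z. if \<epsilon> \<le> d z then (c * h (x, z) / d z) * (c * h (y, z) / d z) else 0"
    have "gram k (x, y) = (\<integral>t. ?f (\<phi> t) \<partial>mu)"
      unfolding gram_def k_def by (auto intro!: Bochner_Integration.integral_cong)
    also have "\<dots> = (\<integral>z. w z * ?f z \<partial>mu)"
      by (rule push) measurable
    also have "\<dots> = (\<integral>z. (if \<epsilon> \<le> d z then h (x, z) * h (y, z) else 0) \<partial>mu)"
    proof (rule Bochner_Integration.integral_cong[OF refl])
      fix z
      have "w z * ((c * h (x, z) / d z) * (c * h (y, z) / d z)) = h (x, z) * h (y, z)" if "\<epsilon> \<le> d z"
      proof -
        have "w z * ((c * h (x, z) / d z) * (c * h (y, z) / d z))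
            = ((d z)\<^sup>2 / Q) * ((c * c) * (h (x, z) * h (y, z)) / (d z)\<^sup>2)"
          using that by (simp add: w_def q_def power2_eq_square)
        also have "\<dots> = h (x, z) * h (y, z)"
          unfolding c(2) using that eps Q_pos by simp
        finally show ?thesis .
      qed
      then show "w z * ?f z = (if \<epsilon> \<le> d z then h (x, z) * h (y, z) else 0)"
        by simp
    qed
    also have "\<dots> \<le> (\<integral>z. h (x, z) * h (y, z) \<partial>mu)"
      using bounded_kernel_mult(1)[OF h] integrable_gram_integrand[OF h xy]
      by (intro integral_mono') auto
    finally show ?thesis
      by (simp add: gram_def)
  qed
  ultimately show thesis
    using that[OF k] Q_ge by simp
qed

section \<open>The equivalence\<close>

theorem theorem3p5:
  fixes G :: "'v graph" and H :: "('v, 'v set) bipartite_graph"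
  assumes "finite_simple_graph G" and "H = Sub G"
  shows "(\<forall>g. completely_positive g \<longrightarrow>
            t_graph G g \<ge> (\<integral>p. g p \<partial>mu2) ^ card (edges G))
     \<longleftrightarrow> (\<forall>h. bdd_meas_nonneg h \<longrightarrow>
            t_bipartite H h \<ge> (\<integral>p. h p \<partial>mu2) ^ card (bip_edges H))"
proof -
  note G = assms(1)
  let ?m = "card (edges G)"
  have power: "a ^ card (bip_edges H) = (a\<^sup>2) ^ ?m" for a :: real
    by (simp add: assms(2) card_bip_edges_Sub[OF G] power_mult)
  show ?thesis
  proof (intro iffI allI impI)
    fix h
    assume cp: "\<forall>g. completely_positive g \<longrightarrow> t_graph G g \<ge> (\<integral>p. g p \<partial>mu2) ^ ?m"
      and h: "bdd_meas_nonneg h"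
    obtain B h0 where h0: "bounded_kernel B h0" and ae: "AE p in mu2. h p = h0 p"
      using h by (rule bdd_meas_nonneg_representative)
    have h_meas: "h \<in> borel_measurable mu2"
      using h by (simp add: bdd_meas_nonneg_def)
    have "completely_positive (gram h0)"
      unfolding completely_positive_def
      using bounded_kernel_imp_bdd_meas_nonneg[OF bounded_kernel_gram[OF h0]]
        bounded_kernel_imp_bdd_meas_nonneg[OF h0]
        gram_commute[of h0]
      by (auto intro!: exI[of _ h0] simp: gram_def)
    then have "(\<integral>p. gram h0 p \<partial>mu2) ^ ?m \<le> t_graph G (gram h0)"
      using cp by simp
    moreover have "((\<integral>p. h p \<partial>mu2)\<^sup>2) ^ ?m \<le> (\<integral>p. gram h0 p \<partial>mu2) ^ ?m"
    proof (rule power_mono)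
      have "(\<integral>p. h p \<partial>mu2) = (\<integral>p. h0 p \<partial>mu2)"
        using ae by (intro integral_cong_AE h_meas bounded_kernel_measurable_mu2[OF h0])
      then show "(\<integral>p. h p \<partial>mu2)\<^sup>2 \<le> (\<integral>p. gram h0 p \<partial>mu2)"
        using square_integral_le_integral_gram[OF h0] by simp
    qed simp
    moreover have "t_bipartite H h = t_graph G (gram h0)"
      using t_bipartite_Sub_cong_AE[OF G h_meas bounded_kernel_measurable_mu2[OF h0] ae]
        t_bipartite_Sub_eq_t_graph_gram[OF G h0] assms(2) by simp
    ultimately show "(\<integral>p. h p \<partial>mu2) ^ card (bip_edges H) \<le> t_bipartite H h"
      by (simp add: power)
  next
    fix g
    assume bip: "\<forall>h. bdd_meas_nonneg h \<longrightarrow> t_bipartite H h \<ge> (\<integral>p. h p \<partial>mu2) ^ card (bip_edges H)"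
      and g: "completely_positive g"
    obtain h where h: "bdd_meas_nonneg h" and gh: "AE (x, y) in mu2. g (x, y) = gram h (x, y)"
      using g unfolding completely_positive_def gram_def by auto
    obtain B h0 where h0: "bounded_kernel B h0" and ae: "AE p in mu2. h p = h0 p"
      using h by (rule bdd_meas_nonneg_representative)
    note gram_h0 = bounded_kernel_gram[OF h0]
    have g_ae: "AE p in mu2. g p = gram h0 p"
      using gh gram_cong_AE[OF h h0 ae] by eventually_elim auto
    have g_meas: "g \<in> borel_measurable mu2"
      using g by (simp add: completely_positive_def bdd_meas_nonneg_def)
    have t_g: "t_graph G g = t_graph G (gram h0)"
      by (rule t_graph_cong_AE[OF G g_meas bounded_kernel_measurable_mu2[OF gram_h0] g_ae])
    define D where "D = (\<integral>p. gram h0 p \<partial>mu2)"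
    have int_g: "(\<integral>p. g p \<partial>mu2) = D"
      unfolding D_def using g_ae by (intro integral_cong_AE g_meas bounded_kernel_measurable_mu2[OF gram_h0])
    have D_nonneg: "0 \<le> D"
      unfolding D_def using bounded_kernelD(2)[OF gram_h0] by (rule Bochner_Integration.integral_nonneg)
    have lower: "(D - \<epsilon>\<^sup>2) ^ ?m \<le> t_graph G (gram h0)" if eps: "0 < \<epsilon>" "\<epsilon>\<^sup>2 < D" for \<epsilon>
    proof -
      obtain C k where k: "bounded_kernel C k"
        and le: "\<And>x y. x \<in> {0..1} \<Longrightarrow> y \<in> {0..1} \<Longrightarrow> gram k (x, y) \<le> gram h0 (x, y)"
        and int_k: "D - \<epsilon>\<^sup>2 \<le> (\<integral>p. k p \<partial>mu2)\<^sup>2"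
        using exists_equalised_kernel[OF h0 eps[unfolded D_def]] unfolding D_def by blast
      have "(D - \<epsilon>\<^sup>2) ^ ?m \<le> ((\<integral>p. k p \<partial>mu2)\<^sup>2) ^ ?m"
        using eps int_k by (intro power_mono) auto
      also have "\<dots> \<le> t_bipartite H k"
        using bip bounded_kernel_imp_bdd_meas_nonneg[OF k] by (simp flip: power)
      also have "\<dots> = t_graph G (gram k)"
        unfolding assms(2) by (rule t_bipartite_Sub_eq_t_graph_gram[OF G k])
      also have "\<dots> \<le> t_graph G (gram h0)"
        by (rule t_graph_mono[OF G bounded_kernel_gram[OF k] gram_h0 le])
      finally show ?thesis .
    qed
    have "D ^ ?m \<le> t_graph G (gram h0)"
    proof (cases "D = 0")
      case True
      (* No kernel can be equalised here. The zero kernel serves instead, and gives the claim also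
         for a graph without edges, where 0 ^ 0 = 1. *)
      have zero: "bounded_kernel 0 (\<lambda>_. 0)"
        by (simp add: bounded_kernel_def)
      have "D ^ ?m \<le> t_bipartite H (\<lambda>_. 0)"
        using bip bounded_kernel_imp_bdd_meas_nonneg[OF zero] True by (force simp: power)
      also have "\<dots> = t_graph G (gram (\<lambda>_. 0))"
        unfolding assms(2) by (rule t_bipartite_Sub_eq_t_graph_gram[OF G zero])
      also have "\<dots> \<le> t_graph G (gram h0)"
        using bounded_kernelD(2)[OF gram_h0]
        by (intro t_graph_mono[OF G bounded_kernel_gram[OF zero] gram_h0]) (simp add: gram_def[of "\<lambda>_. 0"])
      finally show ?thesis .
    next
      case False
      then have "0 < D"
        using D_nonneg by simp
      have "((\<lambda>\<epsilon>. (D - \<epsilon>\<^sup>2) ^ ?m) \<longlongrightarrow> (D - 0\<^sup>2) ^ ?m) (at_right 0)"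
        by (intro tendsto_intros)
      moreover have "\<forall>\<^sub>F \<epsilon> in at_right 0. (D - \<epsilon>\<^sup>2) ^ ?m \<le> t_graph G (gram h0)"
      proof (rule eventually_at_rightI[of 0 "sqrt D"])
        fix \<epsilon> assume "\<epsilon> \<in> {0<..<sqrt D}"
        then show "(D - \<epsilon>\<^sup>2) ^ ?m \<le> t_graph G (gram h0)"
          using power_strict_mono[of \<epsilon> "sqrt D" 2] \<open>0 < D\<close> by (intro lower) auto
      qed (use \<open>0 < D\<close> in simp)
      ultimately show ?thesis
        by (intro tendsto_upperbound[of _ "D ^ ?m" "at_right (0::real)"]) auto
    qed
    then show "(\<integral>p. g p \<partial>mu2) ^ ?m \<le> t_graph G g"
      by (simp add: t_g int_g)
  qed
qed

end
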